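(* Let $\mathfrak{g}=A_{5,5}$ and let $\langle\cdot,\cdot\rangle$ be an inner product on $\mathfrak{g}$. Let $\eta>0$ and let $\{v_1,\dots,v_5\}$ be a basis of $\mathfrak{g}$, orthonormal with respect to $\eta\langle\cdot,\cdot\rangle$, whose only nonzero brackets (up to antisymmetry) are $[v_1,v_2]=\alpha v_4+\beta v_5$, $[v_1,v_3]=\gamma v_5$, $[v_2,v_3]=\delta v_5$, $[v_2,v_4]=\varepsilon v_5$, with $\alpha,\gamma,\varepsilon>0$ and $\beta,\delta\in\mathbb{R}$. Then $\langle\cdot,\cdot\rangle$ is a nilsoliton if and only if $\beta=\delta=0$ and $\alpha=\varepsilon=\sqrt{2}\,\gamma$.
   Context: $A_{5,5}$ is the five-dimensional real nilpotent Lie algebra having a basis with the brackets displayed in the claim. An inner product on $\mathfrak{g}$ is identified with the left-invariant Riemannian metric $g$ it induces on the simply connected Lie group $G$ with Lie algebra $\mathfrak{g}$. Let $ric_g$ be the Ricci curvature tensor of $(G,g)$ (Levi-Civita connection), viewed as a symmetric bilinear form on $\mathfrak{g}$; since $\mathfrak{g}$ is nilpotent, $ric_g(u,v)=-\frac12\mathrm{tr}(ad_u\circ ad_v^* )-\frac14\mathrm{tr}(J_u\circ J_v)$, where $ad_uv=[u,v]$, $ad_v^*$ is the $g$-transpose of $ad_v$, and $J_uv=ad_v^*u$. The Ricci operator $Ric_g$ is defined by $ric_g(u,v)=g(Ric_g(u),v)$. The metric $g$ is a nilsoliton if $Ric_g\in\mathbb{R}\,\mathrm{Id}_{\mathfrak{g}}\oplus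 Der(\mathfrak{g})$, i.e. $Ric_g=c\,\mathrm{Id}+D$ for some $c\in\mathbb{R}$ and some derivation $D$ of $\mathfrak{g}$. *)

theory Defs
  imports "HOL-Analysis.Analysis"
begin

definition lie_bracket :: "('a::real_vector \<Rightarrow> 'a \<Rightarrow> 'a) \<Rightarrow> bool" where
  "lie_bracket br \<longleftrightarrow> bilinear br \<and> (\<forall>x. br x x = 0) \<and>
     (\<forall>x y z. br x (br y z) + br y (br z x) + br z (br x y) = 0)"

definition derivation :: "('a::real_vector \<Rightarrow> 'a \<Rightarrow> 'a) \<Rightarrow> ('a \<Rightarrow> 'a) \<Rightarrow> bool" where
  "derivation br D \<longleftrightarrow> linear D \<and> (\<forall>x y. D (br x y) = br (D x) y + br x (D y))"

definition inner_product :: "('a::real_vector \<Rightarrow> 'a \<Rightarrow> real) \<Rightarrow> bool" where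
  "inner_product g \<longleftrightarrow> bilinear g \<and> (\<forall>x y. g x y = g y x) \<and> (\<forall>x. x \<noteq> 0 \<longrightarrow> g x x > 0)"

definition basis5 :: "(nat \<Rightarrow> 'a::real_vector) \<Rightarrow> bool" where
  "basis5 v \<longleftrightarrow> inj_on v {1..5} \<and> independent (v ` {1..5}) \<and> span (v ` {1..5}) = UNIV"

definition orthonormal5 :: "('a \<Rightarrow> 'a \<Rightarrow> real) \<Rightarrow> (nat \<Rightarrow> 'a) \<Rightarrow> bool" where
  "orthonormal5 g v \<longleftrightarrow>
     (\<forall>i\<in>{1..5}. \<forall>j\<in>{1..5}. g (v i) (v j) = (if i = j then 1 else 0))"

definition A55_brackets ::
  "('a::real_vector \<Rightarrow> 'a \<Rightarrow> 'a) \<Rightarrow> (nat \<Rightarrow> 'a) \<Rightarrow> real \<Rightarrow> real \<Rightarrow> real \<Rightarrow> real \<Rightarrow> real \<Rightarrow> bool" where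
  "A55_brackets br v \<alpha> \<beta> \<gamma> \<delta> \<epsilon> \<longleftrightarrow>
     br (v 1) (v 2) = \<alpha> *\<^sub>R v 4 + \<beta> *\<^sub>R v 5 \<and>
     br (v 1) (v 3) = \<gamma> *\<^sub>R v 5 \<and>
     br (v 2) (v 3) = \<delta> *\<^sub>R v 5 \<and>
     br (v 2) (v 4) = \<epsilon> *\<^sub>R v 5 \<and>
     (\<forall>i\<in>{1..5}. \<forall>j\<in>{1..5}. i < j \<and> (i, j) \<notin> {(1, 2), (1, 3), (2, 3), (2, 4)} \<longrightarrow>
        br (v i) (v j) = 0)"

(* Every Lie algebra having a basis with A55_brackets for some \<alpha>, \<gamma>, \<epsilon> > 0 and real \<beta>, \<delta>
   has one for the parameters chosen here: v1, v2, (\<alpha> * \<epsilon> / \<gamma>) (v3 - (\<delta> / \<epsilon>) v4),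
   \<alpha> v4 + \<beta> v5, (\<alpha> * \<epsilon>) v5. Five-dimensionality and nilpotency follow from the condition. *)
definition is_A55 :: "('a::real_vector \<Rightarrow> 'a \<Rightarrow> 'a) \<Rightarrow> bool" where
  "is_A55 br \<longleftrightarrow> lie_bracket br \<and> (\<exists>e. basis5 e \<and> A55_brackets br e 1 0 1 0 1)"

(* The trace of an endomorphism of a finite-dimensional space; by lin_trace_eq below
   it does not depend on the chosen basis. *)
definition lin_trace :: "('a::real_vector \<Rightarrow> 'a) \<Rightarrow> real" where
  "lin_trace f =
     (let B = (SOME B. independent B \<and> span B = UNIV) in \<Sum>b\<in>B. representation B (f b) b)"

(* The Levi-Civita connection of the left-invariant metric g, restricted to left-invariant
   vector fields. For these, g(V, W) is a constant function, so its derivative along U vanishes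
   and compatibility with the metric reads g (N u v) w + g v (N u w) = 0. *)
definition levi_civita ::
  "('a::real_vector \<Rightarrow> 'a \<Rightarrow> 'a) \<Rightarrow> ('a \<Rightarrow> 'a \<Rightarrow> real) \<Rightarrow> 'a \<Rightarrow> 'a \<Rightarrow> 'a" where
  "levi_civita br g = (THE N. bilinear N \<and>
     (\<forall>u v. N u v - N v u = br u v) \<and>
     (\<forall>u v w. g (N u v) w + g v (N u w) = 0))"

definition curvature ::
  "('a::real_vector \<Rightarrow> 'a \<Rightarrow> 'a) \<Rightarrow> ('a \<Rightarrow> 'a \<Rightarrow> real) \<Rightarrow> 'a \<Rightarrow> 'a \<Rightarrow> 'a \<Rightarrow> 'a" where
  "curvature br g u v w =
     levi_civita br g u (levi_civita br g v w) - levi_civita br g v (levi_civita br g u w)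
     - levi_civita br g (br u v) w"

(* For nilpotent br this is - tr (ad u o A v) / 2 - tr (J u o J v) / 4, where A v is the
   g-transpose of ad v = br v, and J u w = A w u. *)
definition ricci ::
  "('a::real_vector \<Rightarrow> 'a \<Rightarrow> 'a) \<Rightarrow> ('a \<Rightarrow> 'a \<Rightarrow> real) \<Rightarrow> 'a \<Rightarrow> 'a \<Rightarrow> real" where
  "ricci br g u v = lin_trace (\<lambda>w. curvature br g w u v)"

definition ricci_operator ::
  "('a::real_vector \<Rightarrow> 'a \<Rightarrow> 'a) \<Rightarrow> ('a \<Rightarrow> 'a \<Rightarrow> real) \<Rightarrow> 'a \<Rightarrow> 'a" where
  "ricci_operator br g u = (THE r. \<forall>v. ricci br g u v = g r v)"

definition nilsoliton ::
  "('a::real_vector \<Rightarrow> 'a \<Rightarrow> 'a) \<Rightarrow> ('a \<Rightarrow> 'a \<Rightarrow> real) \<Rightarrow> bool" where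
  "nilsoliton br g \<longleftrightarrow>
     (\<exists>c D. derivation br D \<and> (\<forall>u. ricci_operator br g u = c *\<^sub>R u + D u))"

lemma lin_trace_eq:
  fixes f :: "'a::real_vector \<Rightarrow> 'a"
  assumes f: "linear f" and B: "independent B" "span B = UNIV" "finite B"
  shows "lin_trace f = (\<Sum>b\<in>B. representation B (f b) b)"
proof -
  define C where "C = (SOME C::'a set. independent C \<and> span C = UNIV)"
  have "independent C \<and> span C = UNIV"
    unfolding C_def by (rule someI[of _ B]) (use B in auto)
  then have iC: "independent C" and sC: "span C = UNIV" by auto
  have fC: "finite C"
    using independent_span_bound[OF B(3) iC] B(2) by simp
  let ?rB = "representation B" and ?rC = "representation C"
  have sumB: "(\<Sum>b\<in>B. ?rB x b *\<^sub>R b) = x" for x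
    by (rule real_vector.sum_representation_eq) (use B in auto)
  have sumC: "(\<Sum>c\<in>C. ?rC x c *\<^sub>R c) = x" for x
    by (rule real_vector.sum_representation_eq) (use iC sC fC in auto)
  have lB: "?rB (\<Sum>i\<in>I. h i *\<^sub>R z i) b = (\<Sum>i\<in>I. h i * ?rB (z i) b)" for I :: "'a set" and h z b
    using B by (simp add: real_vector.representation_sum real_vector.representation_scale)
  have lC: "?rC (\<Sum>i\<in>I. h i *\<^sub>R z i) b = (\<Sum>i\<in>I. h i * ?rC (z i) b)" for I :: "'a set" and h z b
    using iC sC by (simp add: real_vector.representation_sum real_vector.representation_scale)
  have fe: "f b = (\<Sum>c\<in>C. ?rC b c *\<^sub>R f c)" for b
  proof -
    have "f b = f (\<Sum>c\<in>C. ?rC b c *\<^sub>R c)" by (simp add: sumC)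
    then show ?thesis by (simp add: linear_sum[OF f] linear_scale[OF f])
  qed
  have "(\<Sum>b\<in>B. ?rB (f b) b) = (\<Sum>b\<in>B. \<Sum>c\<in>C. ?rC b c * ?rB (f c) b)"
    by (subst fe) (simp add: lB)
  also have "\<dots> = (\<Sum>c\<in>C. \<Sum>b\<in>B. ?rB (f c) b * ?rC b c)"
    by (subst sum.swap) (simp add: mult.commute)
  also have "\<dots> = (\<Sum>c\<in>C. ?rC (\<Sum>b\<in>B. ?rB (f c) b *\<^sub>R b) c)"
    by (simp add: lC)
  also have "\<dots> = lin_trace f"
    by (simp add: sumB lin_trace_def C_def[symmetric] Let_def)
  finally show ?thesis ..
qed

end

theory Submission
  imports Defs
begin

text \<open>
  Summing the curvature over an orthonormal basis \<open>e\<close> and inserting Koszul's formula yields, for a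
  unimodular bracket,
  \<open>ric(u,v) = - 1/2 \<Sum> \<langle>[u,e k],[v,e k]\<rangle> + 1/4 \<Sum> \<langle>[e k,e l],u\<rangle>\<langle>[e k,e l],v\<rangle> - 1/2 \<Sum> \<langle>[[e k,u],v],e k\<rangle>\<close>.
  After rescaling the given basis to an orthonormal one, the Ricci matrix \<open>R\<close> is explicit. If
  \<open>D = R - c\<close> is a derivation, then \<open>[D e5, e2] = 0\<close> forces \<open>\<beta> = 0\<close>, the \<open>e3\<close>-component of
  \<open>D e4\<close> forces \<open>\<delta> = 0\<close>, and the weights of \<open>[e1,e2]\<close>, \<open>[e1,e3]\<close>, \<open>[e2,e4]\<close> give
  \<open>- 2 c = 3 \<alpha>\<^sup>2 + \<gamma>\<^sup>2 = \<alpha>\<^sup>2 + 3 \<gamma>\<^sup>2 + \<epsilon>\<^sup>2 = 3 \<epsilon>\<^sup>2 + \<gamma>\<^sup>2\<close>. Conversely, at the solution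
  \<open>D\<close> is a multiple of the diagonal derivation with weights \<open>4, 3, 6, 7, 10\<close>.
\<close>

section \<open>Bilinear maps and double sums\<close>

lemma bilinear_sum_left:
  "bilinear f \<Longrightarrow> f (\<Sum>i\<in>I. a i *\<^sub>R x i) y = (\<Sum>i\<in>I. a i *\<^sub>R f (x i) y)"
  by (simp add: bilinear_def linear_sum linear_scale[of "\<lambda>x. f x y"] linear_sum[of "\<lambda>x. f x y"])

lemma bilinear_sum_right:
  "bilinear f \<Longrightarrow> f y (\<Sum>i\<in>I. a i *\<^sub>R x i) = (\<Sum>i\<in>I. a i *\<^sub>R f y (x i))"
  by (simp add: bilinear_def linear_sum linear_scale[of "\<lambda>x. f y x"])

text \<open>Exchanging the names of \<open>k\<close> and \<open>l\<close> turns the sum into its own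
  negative.\<close>

lemma sum_symmetric_antisymmetric:
  fixes S A :: "'i \<Rightarrow> 'i \<Rightarrow> real"
  assumes "\<And>k l. S k l = S l k" "\<And>k l. A k l = - A l k"
  shows "(\<Sum>k\<in>I. \<Sum>l\<in>I. S k l * A k l) = 0"
proof -
  have "(\<Sum>k\<in>I. \<Sum>l\<in>I. S k l * A k l) = (\<Sum>k\<in>I. \<Sum>l\<in>I. S l k * A l k)"
    by (rule sum.swap)
  also have "\<dots> = (\<Sum>k\<in>I. \<Sum>l\<in>I. - (S k l * A k l))"
    using assms by (intro sum.cong refl) (metis mult_minus_right)
  finally show ?thesis by (simp add: sum_negf)
qed

section \<open>Coordinates and traces in an orthonormal basis\<close>

locale orthonormal_basis_algebra =
  fixes br :: "'a::real_vector \<Rightarrow> 'a \<Rightarrow> 'a"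
    and g :: "'a \<Rightarrow> 'a \<Rightarrow> real"
    and e :: "'i \<Rightarrow> 'a"
    and I :: "'i set"
  assumes bilinear_br: "bilinear br"
    and br_self: "br x x = 0"
    and inner_product: "inner_product g"
    and finite_I: "finite I"
    and orthonormal: "\<lbrakk>i \<in> I; j \<in> I\<rbrakk> \<Longrightarrow> g (e i) (e j) = (if i = j then 1 else 0)"
    and span: "span (e ` I) = UNIV"
begin

lemma bilinear_g: "bilinear g"
  and g_commute: "g x y = g y x"
  using inner_product by (auto simp: inner_product_def)

lemmas br_simps = bilinear_ladd[OF bilinear_br] bilinear_radd[OF bilinear_br]
  bilinear_lmul[OF bilinear_br] bilinear_rmul[OF bilinear_br]
  bilinear_lsub[OF bilinear_br] bilinear_rsub[OF bilinear_br]
  bilinear_lneg[OF bilinear_br] bilinear_rneg[OF bilinear_br]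
  bilinear_lzero[OF bilinear_br] bilinear_rzero[OF bilinear_br]

lemmas g_simps = bilinear_ladd[OF bilinear_g] bilinear_radd[OF bilinear_g]
  bilinear_lmul[OF bilinear_g] bilinear_rmul[OF bilinear_g]
  bilinear_lsub[OF bilinear_g] bilinear_rsub[OF bilinear_g]
  bilinear_lneg[OF bilinear_g] bilinear_rneg[OF bilinear_g]
  bilinear_lzero[OF bilinear_g] bilinear_rzero[OF bilinear_g]

lemma br_commute: "br x y = - br y x"
proof -
  have "br (x + y) (x + y) = br x x + br x y + (br y x + br y y)"
    by (simp only: br_simps add_ac)
  then show ?thesis by (simp add: br_self eq_neg_iff_add_eq_0)
qed

text \<open>Both sides are linear in \<open>x\<close> and agree on the basis vectors by
  orthonormality, hence on their span.\<close>

lemma expansion: "(\<Sum>i\<in>I. g x (e i) *\<^sub>R e i) = x"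
proof -
  have "x \<in> span (e ` I)" by (simp add: span)
  then show ?thesis
  proof (induction rule: span_induct_alt)
    case base
    show ?case by (simp add: g_simps)
  next
    case (step c b y)
    then obtain j where j: "j \<in> I" "b = e j" by auto
    have "(\<Sum>i\<in>I. g b (e i) *\<^sub>R e i) = (\<Sum>i\<in>I. if i = j then e j else 0)"
      using j by (intro sum.cong) (auto simp: orthonormal)
    then have "(\<Sum>i\<in>I. g b (e i) *\<^sub>R e i) = b"
      using j finite_I by simp
    then show ?case
      using step by (simp add: g_simps scaleR_add_left sum.distrib scaleR_sum_right[symmetric]
          flip: scaleR_scaleR)
  qed
qed

lemma parseval: "g x y = (\<Sum>i\<in>I. g x (e i) * g y (e i))"
proof -
  have "g x y = g (\<Sum>i\<in>I. g x (e i) *\<^sub>R e i) y" by (simp add: expansion)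
  then show ?thesis by (simp add: bilinear_sum_right[OF bilinear_g] g_commute[of _ y])
qed

lemma g_eqI: "(\<And>z. g x z = g y z) \<Longrightarrow> x = y"
  by (metis (no_types, lifting) expansion sum.cong)

lemma inj_basis: "inj_on e I"
  by (intro inj_onI) (metis orthonormal zero_neq_one)

text \<open>Pairing a vanishing combination with one of its basis vectors isolates the coefficient
  of that vector.\<close>

lemma independent_basis: "independent (e ` I)"
  unfolding independent_explicit_finite_subsets
proof (intro allI impI ballI)
  fix A u b
  assume A: "A \<subseteq> e ` I" "finite A" "(\<Sum>w\<in>A. u w *\<^sub>R w) = 0" "b \<in> A"
  have "0 = g (\<Sum>w\<in>A. u w *\<^sub>R w) b" using A by (simp add: g_simps)
  also have "\<dots> = (\<Sum>w\<in>A. u w * g w b)" by (simp add: bilinear_sum_left[OF bilinear_g])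
  also have "\<dots> = (\<Sum>w\<in>A. if w = b then u b else 0)"
  proof (intro sum.cong refl)
    fix w assume "w \<in> A"
    then obtain i j where "w = e i" "b = e j" "i \<in> I" "j \<in> I"
      using A by blast
    then show "u w * g w b = (if w = b then u b else 0)"
      using inj_basis by (auto simp: orthonormal inj_on_eq_iff)
  qed
  finally show "u b = 0" using A by simp
qed

lemma representation_basis:
  assumes "i \<in> I" shows "representation (e ` I) x (e i) = g x (e i)"
proof -
  have "representation (e ` I) x (e i)
      = representation (e ` I) (\<Sum>j\<in>I. g x (e j) *\<^sub>R e j) (e i)"
    by (simp add: expansion)
  also have "\<dots> = (\<Sum>j\<in>I. g x (e j) * representation (e ` I) (e j) (e i))"
    using independent_basis span
    by (simp add: real_vector.representation_sum real_vector.representation_scale)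
  also have "\<dots> = (\<Sum>j\<in>I. if j = i then g x (e j) else 0)"
    using independent_basis assms inj_basis
    by (intro sum.cong refl)
      (auto simp: real_vector.representation_basis inj_on_eq_iff)
  finally show ?thesis using assms finite_I by simp
qed

lemma lin_trace_orthonormal: "linear f \<Longrightarrow> lin_trace f = (\<Sum>i\<in>I. g (f (e i)) (e i))"
  using independent_basis span finite_I inj_basis
  by (simp add: lin_trace_eq[of f "e ` I"] sum.reindex representation_basis)

section \<open>Koszul's formula and the Levi-Civita connection\<close>

definition koszul :: "'a \<Rightarrow> 'a \<Rightarrow> 'a \<Rightarrow> real" where
  "koszul x y z = (g (br x y) z - g (br y z) x + g (br z x) y) / 2"

text \<open>The vector representing the functional \<open>koszul x y\<close> through
  \<open>g\<close>. Koszul's formula has no derivative terms here, since \<open>g\<close> is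
  constant on left-invariant fields.\<close>

definition nabla :: "'a \<Rightarrow> 'a \<Rightarrow> 'a" where
  "nabla x y = (\<Sum>i\<in>I. koszul x y (e i) *\<^sub>R e i)"

lemma g_nabla: "g (nabla x y) z = koszul x y z"
proof -
  have "koszul x y z = koszul x y (\<Sum>i\<in>I. g z (e i) *\<^sub>R e i)" by (simp add: expansion)
  also have "\<dots> = (\<Sum>i\<in>I. g z (e i) * koszul x y (e i))"
    by (simp add: koszul_def bilinear_sum_right[OF bilinear_g] bilinear_sum_right[OF bilinear_br]
        bilinear_sum_left[OF bilinear_br] bilinear_sum_left[OF bilinear_g] sum_subtractf
        sum.distrib sum_divide_distrib algebra_simps add_divide_distrib diff_divide_distrib)
  finally show ?thesis
    by (simp add: nabla_def bilinear_sum_right[OF bilinear_g] g_commute[of _ z] mult.commute)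
qed

lemma bilinear_nabla: "bilinear nabla"
  unfolding bilinear_def
  by (intro conjI allI linearI g_eqI)
    (auto simp: g_nabla koszul_def g_simps br_simps field_simps)

lemma nabla_torsion_free: "nabla x y - nabla y x = br x y"
proof (rule g_eqI)
  show "g (nabla x y - nabla y x) z = g (br x y) z" for z
    by (simp add: g_nabla koszul_def g_simps br_commute[of y x] br_commute[of z x]
        br_commute[of z y] field_simps)
qed

lemma nabla_metric: "g (nabla x y) z + g y (nabla x z) = 0"
  by (simp add: g_commute[of y] g_nabla koszul_def g_simps br_commute[of z y] br_commute[of y x]
      br_commute[of z x] field_simps)

lemma levi_civita_eq: "levi_civita br g = nabla"
  unfolding levi_civita_def
proof (rule the_equality)
  fix N
  assume "bilinear N \<and> (\<forall>u v. N u v - N v u = br u v) \<and> (\<forall>u v w. g (N u v) w + g v (N u w) = 0)"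
  then have tor: "br u v = N u v - N v u" and met: "g (N u v) w = - g (N u w) v" for u v w
    using g_commute[of v "N u w"] by (auto simp: add_eq_0_iff2)
  \<comment> \<open>Writing the brackets in \<open>koszul\<close> as torsion terms gives six values
    of \<open>N\<close>; three cyclic instances of metric compatibility cancel all but twice
    \<open>g (N x y) z\<close>.\<close>
  have "g (N x y) z = koszul x y z" for x y z
    using met[of x y z] met[of y z x] met[of z x y]
    by (simp add: koszul_def tor g_simps)
  then show "N = nabla"
    by (intro ext g_eqI) (simp add: g_nabla)
qed (use bilinear_nabla nabla_torsion_free nabla_metric in auto)

lemmas nabla_simps = bilinear_ladd[OF bilinear_nabla] bilinear_radd[OF bilinear_nabla]
  bilinear_lmul[OF bilinear_nabla] bilinear_rmul[OF bilinear_nabla]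

section \<open>The Ricci tensor of a unimodular bracket\<close>

lemma ricci_eq_sum: "ricci br g u v = (\<Sum>k\<in>I. g (curvature br g (e k) u v) (e k))"
proof -
  have "linear (\<lambda>w. curvature br g w u v)"
    by (intro linearI)
      (simp_all add: curvature_def levi_civita_eq nabla_simps br_simps algebra_simps)
  then show ?thesis by (simp add: ricci_def lin_trace_orthonormal)
qed

lemma bilinear_ricci: "bilinear (ricci br g)"
  unfolding bilinear_def
  by (intro conjI allI linearI)
    (simp_all add: ricci_eq_sum curvature_def levi_civita_eq nabla_simps br_simps g_simps
      sum.distrib[symmetric] sum_distrib_left algebra_simps)

text \<open>Unimodularity is used through \<open>\<Sum> nabla (e k) (e k) = 0\<close>, which removes the first term of
  the curvature. In the second one, one factor is antisymmetric in \<open>k\<close> and \<open>l\<close>, so that only the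
  antisymmetric part of the other factor survives.\<close>

lemma ricci_unimodular:
  assumes unimodular: "\<And>x. (\<Sum>k\<in>I. g (br x (e k)) (e k)) = 0"
  shows "ricci br g u v =
    - (\<Sum>k\<in>I. g (br u (e k)) (br v (e k))) / 2
    + (\<Sum>k\<in>I. \<Sum>l\<in>I. g (br (e k) (e l)) u * g (br (e k) (e l)) v) / 4
    - (\<Sum>k\<in>I. g (br (br (e k) u) v) (e k)) / 2"
proof -
  \<comment> \<open>\<open>a x\<close> is the matrix of ad \<open>x\<close> in the basis
    \<open>e\<close>, up to transposition; \<open>s\<close> holds the structure constants paired
    with a vector.\<close>
  define s where "s k l x = g (br (e k) (e l)) x" for k l x
  define a where "a x k l = g (br x (e k)) (e l)" for x k l
  have s_anti: "s k l x = - s l k x" for k l x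
    unfolding s_def by (subst br_commute) (simp add: g_simps)
  have "ricci br g u v = (\<Sum>k\<in>I. g (nabla (e k) (nabla u v)) (e k))
      - (\<Sum>k\<in>I. g (nabla u (nabla (e k) v)) (e k)) - (\<Sum>k\<in>I. g (nabla (br (e k) u) v) (e k))"
    by (simp add: ricci_eq_sum curvature_def levi_civita_eq g_simps sum_subtractf)
  moreover have "(\<Sum>k\<in>I. g (nabla (e k) x) (e k)) = 0" for x
    using unimodular[of x]
    by (simp add: g_nabla koszul_def br_self g_simps br_commute[of "e k" x for k] sum_negf)
  moreover have "(\<Sum>k\<in>I. g (nabla u (nabla (e k) v)) (e k))
      = (\<Sum>k\<in>I. \<Sum>l\<in>I. s k l v * a u k l) / 2 - (\<Sum>k\<in>I. \<Sum>l\<in>I. s k l u * s k l v) / 4"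
  proof -
    \<comment> \<open>Metric compatibility moves \<open>nabla u\<close> onto \<open>e k\<close>, and
      Parseval then gives a product of two Koszul expressions.\<close>
    have "g (nabla u (nabla (e k) v)) (e k) = (\<Sum>l\<in>I. (a v k l + a v l k + s k l v)
        * (a u k l - a u l k - s k l u)) / 4" for k
    proof -
      have "g (nabla u (nabla (e k) v)) (e k) = - g (nabla (e k) v) (nabla u (e k))"
        using nabla_metric[of u "nabla (e k) v" "e k"] by simp
      also have "\<dots> = (\<Sum>l\<in>I. - (koszul (e k) v (e l) * koszul u (e k) (e l)))"
        by (subst parseval) (simp add: g_nabla sum_negf)
      also have "\<dots> = (\<Sum>l\<in>I. (a v k l + a v l k + s k l v) * (a u k l - a u l k - s k l u) / 4)"
        by (intro sum.cong refl)
          (simp add: koszul_def a_def s_def br_commute[of _ u] br_commute[of _ v]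
            br_commute[of "e l" "e k" for l] g_simps field_simps)
      finally show ?thesis by (simp add: sum_divide_distrib)
    qed
    then have "(\<Sum>k\<in>I. g (nabla u (nabla (e k) v)) (e k)) =
        (\<Sum>k\<in>I. \<Sum>l\<in>I. (a v k l + a v l k + s k l v) * (a u k l - a u l k - s k l u)) / 4"
      by (simp only: sum_divide_distrib)
    also have "\<dots> =
        (\<Sum>k\<in>I. \<Sum>l\<in>I. (a v k l + a v l k) * (a u k l - a u l k - s k l u)) / 4
        + ((\<Sum>k\<in>I. \<Sum>l\<in>I. s k l v * a u k l) - (\<Sum>k\<in>I. \<Sum>l\<in>I. s k l v * a u l k)
        - (\<Sum>k\<in>I. \<Sum>l\<in>I. s k l u * s k l v)) / 4"
      by (simp add: algebra_simps sum.distrib sum_subtractf add_divide_distrib diff_divide_distrib)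
    also have "(\<Sum>k\<in>I. \<Sum>l\<in>I. (a v k l + a v l k) * (a u k l - a u l k - s k l u)) = 0"
    proof (rule sum_symmetric_antisymmetric)
      show "a u k l - a u l k - s k l u = - (a u l k - a u k l - s l k u)" for k l
        using s_anti[of k l u] by simp
    qed simp
    \<comment> \<open>Antisymmetry of \<open>s\<close> makes the two mixed sums add up instead of
      cancelling.\<close>
    also have "(\<Sum>k\<in>I. \<Sum>l\<in>I. s k l v * a u l k) = - (\<Sum>k\<in>I. \<Sum>l\<in>I. s k l v * a u k l)"
    proof -
      have "(\<Sum>k\<in>I. \<Sum>l\<in>I. s k l v * a u l k) = (\<Sum>k\<in>I. \<Sum>l\<in>I. - (s l k v * a u l k))"
        by (intro sum.cong refl) (metis s_anti mult_minus_left)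
      also have "\<dots> = (\<Sum>k\<in>I. \<Sum>l\<in>I. - (s k l v * a u k l))"
        by (rule sum.swap)
      finally show ?thesis by (simp add: sum_negf)
    qed
    finally show ?thesis by simp
  qed
  \<comment> \<open>The mixed sum of \<open>s\<close> and \<open>a\<close> returns with the opposite
    sign, so it drops out of the Ricci tensor.\<close>
  moreover have "(\<Sum>k\<in>I. g (nabla (br (e k) u) v) (e k))
      = (\<Sum>k\<in>I. g (br (br (e k) u) v) (e k)) / 2 + (\<Sum>k\<in>I. g (br u (e k)) (br v (e k))) / 2
        - (\<Sum>k\<in>I. \<Sum>l\<in>I. s k l v * a u k l) / 2"
  proof -
    have "g (br (e k) (br u (e k))) v = (\<Sum>l\<in>I. s k l v * a u k l)" for k
    proof -
      have "g (br (e k) (br u (e k))) v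
          = g (br (e k) (\<Sum>l\<in>I. a u k l *\<^sub>R e l)) v"
        by (simp add: a_def expansion)
      then show ?thesis
        by (simp add: bilinear_sum_right[OF bilinear_br] bilinear_sum_left[OF bilinear_g] s_def
            mult.commute)
    qed
    then have "g (nabla (br (e k) u) v) (e k) = g (br (br (e k) u) v) (e k) / 2
        + g (br u (e k)) (br v (e k)) / 2 - (\<Sum>l\<in>I. s k l v * a u k l) / 2" for k
      by (simp add: g_nabla koszul_def br_commute[of "e k" u] br_simps g_simps
          g_commute[of "br v (e k)"] field_simps)
    then show ?thesis by (simp add: sum.distrib sum_subtractf sum_divide_distrib)
  qed
  ultimately show ?thesis by (simp add: s_def mult.commute)
qed

text \<open>The sum represents \<open>ricci br g u\<close> through \<open>g\<close>, and
  nondegeneracy makes it the only such vector.\<close>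

lemma ricci_operator_eq: "ricci_operator br g u = (\<Sum>j\<in>I. ricci br g u (e j) *\<^sub>R e j)"
  unfolding ricci_operator_def
proof (rule the_equality)
  show "\<forall>v. ricci br g u v = g (\<Sum>j\<in>I. ricci br g u (e j) *\<^sub>R e j) v"
  proof
    fix v
    have "ricci br g u v = ricci br g u (\<Sum>j\<in>I. g v (e j) *\<^sub>R e j)" by (simp add: expansion)
    then show "ricci br g u v = g (\<Sum>j\<in>I. ricci br g u (e j) *\<^sub>R e j) v"
      by (simp add: bilinear_sum_right[OF bilinear_ricci] bilinear_sum_right[OF bilinear_g]
          g_commute[of _ v] mult.commute)
  qed
  then show "r = (\<Sum>j\<in>I. ricci br g u (e j) *\<^sub>R e j)" if "\<forall>v. ricci br g u v = g r v" for r
    using that by (intro g_eqI) metis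
qed

lemma linear_ricci_operator: "linear (ricci_operator br g)"
  by (intro linearI)
    (simp_all add: ricci_operator_eq bilinear_ladd[OF bilinear_ricci]
      bilinear_lmul[OF bilinear_ricci] scaleR_add_left sum.distrib scaleR_sum_right)

text \<open>Both sides of the Leibniz rule are bilinear, so a spanning set suffices.\<close>

lemma derivation_basisI:
  assumes D: "linear D"
    and *: "\<And>i j. \<lbrakk>i \<in> I; j \<in> I\<rbrakk> \<Longrightarrow> D (br (e i) (e j)) = br (D (e i)) (e j) + br (e i) (D (e j))"
  shows "derivation br D"
proof -
  have "bilinear (\<lambda>x y. D (br x y))" "bilinear (\<lambda>x y. br (D x) y + br x (D y))"
    unfolding bilinear_def using D
    by (auto intro!: linearI simp: br_simps linear_add linear_scale algebra_simps)
  then have "D (br x y) = br (D x) y + br x (D y)" for x y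
    by (rule bilinear_eq[where S = UNIV and T = UNIV and B = "e ` I" and C = "e ` I"])
      (use span * in auto)
  then show ?thesis using D by (simp add: derivation_def)
qed

end

section \<open>Ricci matrix and nilsoliton condition in an orthonormal basis\<close>

lemma sum_1_5: "(\<Sum>k\<in>{1..5::nat}. f k) = f 1 + f 2 + f 3 + f 4 + f 5"
  for f :: "nat \<Rightarrow> 'b::comm_monoid_add"
  by (simp add: eval_nat_numeral)

locale orthonormal_A55 = orthonormal_basis_algebra br g e "{1..5::nat}"
  for br :: "'a::real_vector \<Rightarrow> 'a \<Rightarrow> 'a" and g and e :: "nat \<Rightarrow> 'a" +
  fixes \<alpha> \<beta> \<gamma> \<delta> \<epsilon> :: real
  assumes brackets: "A55_brackets br e \<alpha> \<beta> \<gamma> \<delta> \<epsilon>"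
    and pos: "\<alpha> > 0" "\<gamma> > 0" "\<epsilon> > 0"
begin

text \<open>Keeps the index in \<open>e 1\<close> literal, so that the bracket table applies to
  it.\<close>

context
  notes One_nat_def [simp del]
begin

lemma br_basis:
  shows "br (e 1) (e 2) = \<alpha> *\<^sub>R e 4 + \<beta> *\<^sub>R e 5" "br (e 2) (e 1) = - (\<alpha> *\<^sub>R e 4 + \<beta> *\<^sub>R e 5)"
    and "br (e 1) (e 3) = \<gamma> *\<^sub>R e 5" "br (e 3) (e 1) = - (\<gamma> *\<^sub>R e 5)"
    and "br (e 2) (e 3) = \<delta> *\<^sub>R e 5" "br (e 3) (e 2) = - (\<delta> *\<^sub>R e 5)"
    and "br (e 2) (e 4) = \<epsilon> *\<^sub>R e 5" "br (e 4) (e 2) = - (\<epsilon> *\<^sub>R e 5)"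
    and "br (e 1) (e 4) = 0" "br (e 4) (e 1) = 0" "br (e 1) (e 5) = 0" "br (e 5) (e 1) = 0"
    and "br (e 2) (e 5) = 0" "br (e 5) (e 2) = 0" "br (e 3) (e 4) = 0" "br (e 4) (e 3) = 0"
    and "br (e 3) (e 5) = 0" "br (e 5) (e 3) = 0" "br (e 4) (e 5) = 0" "br (e 5) (e 4) = 0"
proof -
  have zero: "br (e i) (e j) = 0" "br (e j) (e i) = 0"
    if "i \<in> {1..5}" "j \<in> {1..5}" "i < j" "(i, j) \<notin> {(1, 2), (1, 3), (2, 3), (2, 4)}" for i j
    using brackets that br_commute[of "e j" "e i"] unfolding A55_brackets_def by auto
  show "br (e 1) (e 2) = \<alpha> *\<^sub>R e 4 + \<beta> *\<^sub>R e 5" "br (e 1) (e 3) = \<gamma> *\<^sub>R e 5"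
    "br (e 2) (e 3) = \<delta> *\<^sub>R e 5" "br (e 2) (e 4) = \<epsilon> *\<^sub>R e 5"
    using brackets unfolding A55_brackets_def by auto
  then show "br (e 2) (e 1) = - (\<alpha> *\<^sub>R e 4 + \<beta> *\<^sub>R e 5)" "br (e 3) (e 1) = - (\<gamma> *\<^sub>R e 5)"
    "br (e 3) (e 2) = - (\<delta> *\<^sub>R e 5)" "br (e 4) (e 2) = - (\<epsilon> *\<^sub>R e 5)"
    using br_commute by metis+
  show "br (e 1) (e 4) = 0" "br (e 4) (e 1) = 0" "br (e 1) (e 5) = 0" "br (e 5) (e 1) = 0"
    "br (e 2) (e 5) = 0" "br (e 5) (e 2) = 0" "br (e 3) (e 4) = 0" "br (e 4) (e 3) = 0"
    "br (e 3) (e 5) = 0" "br (e 5) (e 3) = 0" "br (e 4) (e 5) = 0" "br (e 5) (e 4) = 0"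
    by (rule zero; simp; fail)+
qed

lemmas table_simps = sum_1_5 br_basis br_self br_simps g_simps orthonormal

text \<open>\<open>br (e i) (e k)\<close> has components only at indices above \<open>i\<close> and
  \<open>k\<close>, so every ad has zero diagonal.\<close>

lemma unimodular: "(\<Sum>k\<in>{1..5}. g (br x (e k)) (e k)) = 0"
proof -
  have "br x (e k) = (\<Sum>i\<in>{1..5}. g x (e i) *\<^sub>R br (e i) (e k))" for k
    by (simp add: expansion flip: bilinear_sum_left[OF bilinear_br])
  then show ?thesis by (simp add: table_simps)
qed

text \<open>The trace term of the Ricci formula vanishes by nilpotency. On the diagonal, brackets
  taken with \<open>e i\<close> count negatively and brackets with a component along
  \<open>e i\<close> positively.\<close>

lemma ricci_operator_basis:
  "ricci_operator br g (e 1) = (- (\<alpha>\<^sup>2 + \<beta>\<^sup>2 + \<gamma>\<^sup>2) / 2) *\<^sub>R e 1 + (- \<gamma> * \<delta> / 2) *\<^sub>R e 2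
    + (\<beta> * \<delta> / 2) *\<^sub>R e 3 + (\<beta> * \<epsilon> / 2) *\<^sub>R e 4"
  "ricci_operator br g (e 2) = (- \<gamma> * \<delta> / 2) *\<^sub>R e 1
    + (- (\<alpha>\<^sup>2 + \<beta>\<^sup>2 + \<delta>\<^sup>2 + \<epsilon>\<^sup>2) / 2) *\<^sub>R e 2 + (- \<beta> * \<gamma> / 2) *\<^sub>R e 3"
  "ricci_operator br g (e 3) = (\<beta> * \<delta> / 2) *\<^sub>R e 1 + (- \<beta> * \<gamma> / 2) *\<^sub>R e 2
    + (- (\<gamma>\<^sup>2 + \<delta>\<^sup>2) / 2) *\<^sub>R e 3 + (- \<delta> * \<epsilon> / 2) *\<^sub>R e 4"
  "ricci_operator br g (e 4) = (\<beta> * \<epsilon> / 2) *\<^sub>R e 1 + (- \<delta> * \<epsilon> / 2) *\<^sub>R e 3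
    + ((\<alpha>\<^sup>2 - \<epsilon>\<^sup>2) / 2) *\<^sub>R e 4 + (\<alpha> * \<beta> / 2) *\<^sub>R e 5"
  "ricci_operator br g (e 5) = (\<alpha> * \<beta> / 2) *\<^sub>R e 4 + ((\<beta>\<^sup>2 + \<gamma>\<^sup>2 + \<delta>\<^sup>2 + \<epsilon>\<^sup>2) / 2) *\<^sub>R e 5"
  by (simp_all add: ricci_operator_eq ricci_unimodular[OF unimodular] table_simps
      power2_eq_square mult.commute)

lemma nilsolitonD:
  assumes "nilsoliton br g"
  shows "\<beta> = 0 \<and> \<delta> = 0 \<and> \<alpha> = sqrt 2 * \<gamma> \<and> \<epsilon> = sqrt 2 * \<gamma>"
proof -
  obtain c D where D: "derivation br D" "\<And>u. ricci_operator br g u = c *\<^sub>R u + D u"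
    using assms by (auto simp: nilsoliton_def)
  have D_basis: "D (e i) = ricci_operator br g (e i) - c *\<^sub>R e i" for i
    by (simp add: D(2))
  have leibniz: "g (D (br x y)) z = g (br (D x) y) z + g (br x (D y)) z" for x y z
    using D(1) by (simp add: derivation_def g_simps)
  have linear: "D (x + y) = D x + D y" "D (a *\<^sub>R x) = a *\<^sub>R D x" "D 0 = 0" for x y a
    using D(1) by (simp_all add: derivation_def linear_add linear_scale linear_0)
  note simps = linear D_basis ricci_operator_basis table_simps
  \<comment> \<open>As \<open>br (e 5) (e 2) = 0\<close>, the \<open>e 4\<close>-part of
    \<open>D (e 5)\<close> must commute with \<open>e 2\<close>, so \<alpha> \<beta> \<epsilon> =
    0.\<close>
  have \<beta>: "\<beta> = 0"
    using leibniz[of "e 5" "e 2" "e 5"] pos by (simp add: simps)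
  \<comment> \<open>No bracket has an \<open>e 3\<close>-component, so that of
    \<open>D (e 4)\<close> must vanish.\<close>
  have \<delta>: "\<delta> = 0"
    using leibniz[of "e 1" "e 2" "e 3"] pos by (simp add: simps \<beta>)
  \<comment> \<open>Now \<open>D\<close> is diagonal, and each nonzero bracket makes its eigenvalues
    additive; the outer factor is the structure constant.\<close>
  have "\<alpha> * (- 2 * c) = \<alpha> * (3 * \<alpha>\<^sup>2 + \<gamma>\<^sup>2)"
    using leibniz[of "e 1" "e 2" "e 4"] by (simp add: simps \<beta> \<delta> field_simps)
  moreover have "\<gamma> * (- 2 * c) = \<gamma> * (\<alpha>\<^sup>2 + 3 * \<gamma>\<^sup>2 + \<epsilon>\<^sup>2)"
    using leibniz[of "e 1" "e 3" "e 5"] by (simp add: simps \<beta> \<delta> field_simps)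
  moreover have "\<epsilon> * (- 2 * c) = \<epsilon> * (3 * \<epsilon>\<^sup>2 + \<gamma>\<^sup>2)"
    using leibniz[of "e 2" "e 4" "e 5"] by (simp add: simps \<beta> \<delta> field_simps)
  ultimately have "3 * \<alpha>\<^sup>2 + \<gamma>\<^sup>2 = - 2 * c" "\<alpha>\<^sup>2 + 3 * \<gamma>\<^sup>2 + \<epsilon>\<^sup>2 = - 2 * c" "3 * \<epsilon>\<^sup>2 + \<gamma>\<^sup>2 = - 2 * c"
    using pos by (metis mult_left_cancel less_irrefl)+
  then have "\<alpha>\<^sup>2 = 2 * \<gamma>\<^sup>2" "\<epsilon>\<^sup>2 = 2 * \<gamma>\<^sup>2" by linarith+
  then have "\<alpha> = sqrt (2 * \<gamma>\<^sup>2)" "\<epsilon> = sqrt (2 * \<gamma>\<^sup>2)"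
    using pos by (metis real_sqrt_unique less_imp_le)+
  then show ?thesis
    using \<beta> \<delta> pos by (simp add: real_sqrt_mult)
qed

lemma nilsolitonI:
  assumes "\<beta> = 0" "\<delta> = 0" "\<alpha> = sqrt 2 * \<gamma>" "\<epsilon> = sqrt 2 * \<gamma>"
  shows "nilsoliton br g"
proof -
  \<comment> \<open>The constant comes from
    \<open>- 2 * c = 3 * \<alpha>\<^sup>2 + \<gamma>\<^sup>2\<close>, which equals
    \<open>7 * \<gamma>\<^sup>2\<close> at the solution.\<close>
  define D where "D u = ricci_operator br g u - (- 7 * \<gamma>\<^sup>2 / 2) *\<^sub>R u" for u
  have linear: "linear D"
    unfolding D_def by (intro linear_compose_sub linear_ricci_operator linear_scale_self)
  have squares: "\<alpha>\<^sup>2 = 2 * \<gamma>\<^sup>2" "\<epsilon>\<^sup>2 = 2 * \<gamma>\<^sup>2"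
    using assms by (simp_all add: power_mult_distrib)
  have D_basis: "D (e 1) = (4 * (\<gamma>\<^sup>2 / 2)) *\<^sub>R e 1" "D (e 2) = (3 * (\<gamma>\<^sup>2 / 2)) *\<^sub>R e 2"
    "D (e 3) = (6 * (\<gamma>\<^sup>2 / 2)) *\<^sub>R e 3" "D (e 4) = (7 * (\<gamma>\<^sup>2 / 2)) *\<^sub>R e 4"
    "D (e 5) = (10 * (\<gamma>\<^sup>2 / 2)) *\<^sub>R e 5"
    by (simp_all add: D_def ricci_operator_basis assms(1,2) squares flip: scaleR_add_left
        scaleR_diff_left)
  \<comment> \<open>The weights fit the three remaining brackets: 4 + 3 = 7, 4 + 6 = 10 and 3 + 7 =
    10.\<close>
  have "derivation br D"
  proof (rule derivation_basisI[OF linear])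
    fix i j :: nat assume "i \<in> {1..5}" "j \<in> {1..5}"
    then have "i = 1 \<or> i = 2 \<or> i = 3 \<or> i = 4 \<or> i = 5" "j = 1 \<or> j = 2 \<or> j = 3 \<or> j = 4 \<or> j = 5"
      by auto
    then show "D (br (e i) (e j)) = br (D (e i)) (e j) + br (e i) (D (e j))"
      by (elim disjE) (simp_all add: D_basis br_basis br_self br_simps assms(1,2)
          linear_scale[OF linear] linear_0[OF linear] linear_neg[OF linear]
          flip: scaleR_add_left scaleR_diff_left scaleR_minus_left)
  qed
  then show ?thesis
    unfolding nilsoliton_def by (intro exI[of _ "- 7 * \<gamma>\<^sup>2 / 2"] exI[of _ D]) (simp add: D_def)
qed

end

end

section \<open>Reduction to an orthonormal basis by rescaling\<close>

theorem corollary5: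
  fixes br :: "'a::real_vector \<Rightarrow> 'a \<Rightarrow> 'a"
    and ip :: "'a \<Rightarrow> 'a \<Rightarrow> real"
    and v :: "nat \<Rightarrow> 'a"
    and \<eta> \<alpha> \<beta> \<gamma> \<delta> \<epsilon> :: real
  assumes "is_A55 br"
    and "inner_product ip"
    and "\<eta> > 0"
    and "basis5 v"
    and "orthonormal5 (\<lambda>x y. \<eta> * ip x y) v"
    and "A55_brackets br v \<alpha> \<beta> \<gamma> \<delta> \<epsilon>"
    and "\<alpha> > 0" "\<gamma> > 0" "\<epsilon> > 0"
  shows "nilsoliton br ip \<longleftrightarrow> \<beta> = 0 \<and> \<delta> = 0 \<and> \<alpha> = sqrt 2 * \<gamma> \<and> \<epsilon> = sqrt 2 * \<gamma>"
proof -
  \<comment> \<open>Scaling the basis by \<open>r\<close> multiplies its inner products by \<eta>,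
    making it orthonormal for \<open>ip\<close>. Brackets scale by \<open>r * r\<close> and the
    targets absorb one factor, so each structure constant gains one \<open>r\<close>.\<close>
  define r where "r = sqrt \<eta>"
  have r: "r > 0" "r * r = \<eta>" using assms(3) by (auto simp: r_def)
  define e where "e i = r *\<^sub>R v i" for i
  have br: "bilinear br" "br x x = 0" for x
    using assms(1) by (auto simp: is_A55_def lie_bracket_def)
  have ip: "bilinear ip" using assms(2) by (simp add: inner_product_def)
  have "v i \<in> span (e ` {1..5})" if "i \<in> {1..5}" for i
  proof -
    have "v i = (1 / r) *\<^sub>R e i" using r by (simp add: e_def)
    then show ?thesis using that by (metis span_base span_scale imageI)
  qed
  then have "span (v ` {1..5}) \<subseteq> span (e ` {1..5})"
    by (intro span_minimal) auto
  then have span: "span (e ` {1..5}) = UNIV"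
    using assms(4) by (auto simp: basis5_def)
  have "ip (e i) (e j) = (if i = j then 1 else 0)" if "i \<in> {1..5}" "j \<in> {1..5}" for i j
    using assms(5) that r
    by (simp add: orthonormal5_def e_def bilinear_lmul[OF ip] bilinear_rmul[OF ip] flip: mult.assoc)
  moreover have "A55_brackets br e (r * \<alpha>) (r * \<beta>) (r * \<gamma>) (r * \<delta>) (r * \<epsilon>)"
    using assms(6) unfolding A55_brackets_def
    by (simp add: e_def bilinear_lmul[OF br(1)] bilinear_rmul[OF br(1)] scaleR_add_right mult_ac)
  ultimately interpret orthonormal_A55 br ip e "r * \<alpha>" "r * \<beta>" "r * \<gamma>" "r * \<delta>" "r * \<epsilon>"
    by unfold_locales (use br assms span r in auto)
  \<comment> \<open>The equations are homogeneous in the parameters, so the positive factor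
    \<open>r\<close> cancels.\<close>
  have "nilsoliton br ip \<longleftrightarrow> r * \<beta> = 0 \<and> r * \<delta> = 0 \<and> r * \<alpha> = sqrt 2 * (r * \<gamma>)
      \<and> r * \<epsilon> = sqrt 2 * (r * \<gamma>)"
    using nilsolitonD nilsolitonI by blast
  then show ?thesis
    using r by (simp add: mult.left_commute[of _ r])
qed

end
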